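(* Let $\Gamma=(V,E)$ be a finite hypergraph and $\mathcal{M}$ a motion sheaf on $I(\Gamma)$ determined by subspaces $S_v\le\mathbb{V}$ with $\bigcap_{v\in V}S_v=0$. If $\mathcal{M}$ is independent, then for every sub-hypergraph $\Gamma'=(V',E')$ of $\Gamma$ with $\bigcap_{x\in V'}S_x=0$, $$\sum_{e\in E'}\Big(\sum_{v\in e}\dim\mathcal{M}(v)-\dim\mathcal{M}(e)\Big)\le\sum_{v\in V'}\dim\mathcal{M}(v)-\dim\mathbb{V}.$$ If $\mathcal{M}$ is minimally rigid, then moreover $$\sum_{e\in E}\Big(\sum_{v\in e}\dim\mathcal{M}(v)-\dim\mathcal{M}(e)\Big)=\sum_{v\in V}\dim\mathcal{M}(v)-\dim\mathbb{V}.$$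
   Context: $I(\Gamma)$: incidence graph with vertex set $V\cup E$ and an edge $v\sim e$ whenever $v\in e$. Motion sheaf from subspaces $S_v$ of a finite-dimensional real vector space $\mathbb{V}$: $S(e)=\bigcap_{v\in e}S_v$, $\mathcal{M}(v)=\mathbb{V}/S_v$, $\mathcal{M}(e)=\mathbb{V}/S(e)$, $\mathcal{M}(v\sim e)=\mathbb{V}/S_v$, restriction maps the identity and the reduction modulo $S_v$. Cohomology: $H^0=\ker d$, $H^1=\operatorname{coker} d$ for the signed coboundary $d(w)_i=\sum_{x\in i}[x:i]r^x_i(w_x)$ ($[x:i]=-[y:i]$ for $i=xy$). $\mathcal{M}$ is independent if $H^1(I(\Gamma),\mathcal{M})=0$; rigid if $I(\Gamma)$ is connected and every element of $H^0(I(\Gamma),\mathcal{M})$ is of the form $(W \bmod S(x))_{x\in V\cup E}$ for some $W\in\mathbb{V}$; minimally rigid if independent and rigid. A sub-hypergraph $(V',E')$ has $V'\subseteq V$, $E'\subseteq E$ and $e\subseteq V'$ for each $e\in E'$. *)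

theory Defs
  imports "HOL-Algebra.AbelCoset" "Jordan_Normal_Form.VS_Connect"
begin

section \<open>Real vector spaces: dimension, quotients, finite products\<close>

type_synonym 'm rvs = "(real, 'm) module"

abbreviation real_vs :: "'m rvs \<Rightarrow> bool" where
  "real_vs M \<equiv> vectorspace class_ring M"

abbreviation rdim :: "'m rvs \<Rightarrow> nat" where
  "rdim M \<equiv> vectorspace.dim class_ring M"

text \<open>The multiplicative fields of a module record carry no information.\<close>

definition quot_vs :: "'m rvs \<Rightarrow> 'm set \<Rightarrow> 'm set rvs" where
  "quot_vs M N =
     \<lparr>carrier = a_rcosets\<^bsub>M\<^esub> N,
      mult = undefined, one = undefined,
      zero = N,
      add = (\<lambda>A B. A <+>\<^bsub>M\<^esub> B),
      smult = (\<lambda>a A. \<Union>x\<in>A. N +>\<^bsub>M\<^esub> (a \<odot>\<^bsub>M\<^esub> x))\<rparr>"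

definition prod_vs :: "'j set \<Rightarrow> ('j \<Rightarrow> 'm rvs) \<Rightarrow> ('j \<Rightarrow> 'm) rvs" where
  "prod_vs J M =
     \<lparr>carrier = (\<Pi>\<^sub>E j\<in>J. carrier (M j)),
      mult = undefined, one = undefined,
      zero = (\<lambda>j\<in>J. \<zero>\<^bsub>M j\<^esub>),
      add = (\<lambda>f g. \<lambda>j\<in>J. f j \<oplus>\<^bsub>M j\<^esub> g j),
      smult = (\<lambda>a f. \<lambda>j\<in>J. a \<odot>\<^bsub>M j\<^esub> f j)\<rparr>"

section \<open>Cellular sheaves on graphs and their cohomology\<close>

record ('x, 'i) graph =
  gverts :: "'x set"
  gedges :: "'i set"
  gends :: "'i \<Rightarrow> 'x set"

definition simple_graph :: "('x, 'i) graph \<Rightarrow> bool" where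
  "simple_graph G \<longleftrightarrow>
     (\<forall>i\<in>gedges G. gends G i \<subseteq> gverts G \<and> card (gends G i) = 2) \<and>
     inj_on (gends G) (gedges G)"

definition graph_connected :: "('x, 'i) graph \<Rightarrow> bool" where
  "graph_connected G \<longleftrightarrow>
     (\<forall>x\<in>gverts G. \<forall>y\<in>gverts G. (x, y) \<in> {(a, b). \<exists>i\<in>gedges G. gends G i = {a, b}}\<^sup>*)"

text \<open>A choice of signs \<open>[x:i]\<close>, equivalently an orientation of every edge.\<close>

definition orientation :: "('x, 'i) graph \<Rightarrow> ('x \<Rightarrow> 'i \<Rightarrow> real) \<Rightarrow> bool" where
  "orientation G \<sigma> \<longleftrightarrow>
     (\<forall>i\<in>gedges G.
        (\<forall>x\<in>gends G i. \<sigma> x i \<in> {1, -1}) \<and>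
        (\<forall>x\<in>gends G i. \<forall>y\<in>gends G i. x \<noteq> y \<longrightarrow> \<sigma> x i = - \<sigma> y i))"

record ('x, 'i, 'm) sheaf =
  vstalk :: "'x \<Rightarrow> 'm rvs"
  estalk :: "'i \<Rightarrow> 'm rvs"
  restr :: "'x \<Rightarrow> 'i \<Rightarrow> 'm \<Rightarrow> 'm"

definition sheaf_on :: "('x, 'i) graph \<Rightarrow> ('x, 'i, 'm) sheaf \<Rightarrow> bool" where
  "sheaf_on G F \<longleftrightarrow>
     (\<forall>x\<in>gverts G. real_vs (vstalk F x)) \<and>
     (\<forall>i\<in>gedges G. real_vs (estalk F i)) \<and>
     (\<forall>i\<in>gedges G. \<forall>x\<in>gends G i.
        restr F x i \<in> LinearCombinations.module_hom class_ring (vstalk F x) (estalk F i))"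

definition cochain0 :: "('x, 'i) graph \<Rightarrow> ('x, 'i, 'm) sheaf \<Rightarrow> ('x \<Rightarrow> 'm) rvs" where
  "cochain0 G F = prod_vs (gverts G) (vstalk F)"

definition cochain1 :: "('x, 'i) graph \<Rightarrow> ('x, 'i, 'm) sheaf \<Rightarrow> ('i \<Rightarrow> 'm) rvs" where
  "cochain1 G F = prod_vs (gedges G) (estalk F)"

definition coboundary ::
  "('x, 'i) graph \<Rightarrow> ('x \<Rightarrow> 'i \<Rightarrow> real) \<Rightarrow> ('x, 'i, 'm) sheaf \<Rightarrow> ('x \<Rightarrow> 'm) \<Rightarrow> ('i \<Rightarrow> 'm)" where
  "coboundary G \<sigma> F w =
     (\<lambda>i\<in>gedges G. finsum (estalk F i) (\<lambda>x. \<sigma> x i \<odot>\<^bsub>estalk F i\<^esub> restr F x i (w x)) (gends G i))"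

definition cohomology0 ::
  "('x, 'i) graph \<Rightarrow> ('x \<Rightarrow> 'i \<Rightarrow> real) \<Rightarrow> ('x, 'i, 'm) sheaf \<Rightarrow> ('x \<Rightarrow> 'm) rvs" where
  "cohomology0 G \<sigma> F =
     (cochain0 G F)\<lparr>carrier :=
        {w \<in> carrier (cochain0 G F). coboundary G \<sigma> F w = \<zero>\<^bsub>cochain1 G F\<^esub>}\<rparr>"

definition cohomology1 ::
  "('x, 'i) graph \<Rightarrow> ('x \<Rightarrow> 'i \<Rightarrow> real) \<Rightarrow> ('x, 'i, 'm) sheaf \<Rightarrow> ('i \<Rightarrow> 'm) set rvs" where
  "cohomology1 G \<sigma> F =
     quot_vs (cochain1 G F) (coboundary G \<sigma> F ` carrier (cochain0 G F))"

definition independent_sheaf ::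
  "('x, 'i) graph \<Rightarrow> ('x \<Rightarrow> 'i \<Rightarrow> real) \<Rightarrow> ('x, 'i, 'm) sheaf \<Rightarrow> bool" where
  "independent_sheaf G \<sigma> F \<longleftrightarrow>
     carrier (cohomology1 G \<sigma> F) = {\<zero>\<^bsub>cohomology1 G \<sigma> F\<^esub>}"

section \<open>Hypergraphs, incidence graphs and motion sheaves\<close>

definition finite_hypergraph :: "'v set \<Rightarrow> 'v set set \<Rightarrow> bool" where
  "finite_hypergraph V E \<longleftrightarrow> finite V \<and> E \<subseteq> Pow V"

definition sub_hypergraph :: "'v set \<Rightarrow> 'v set set \<Rightarrow> 'v set \<Rightarrow> 'v set set \<Rightarrow> bool" where
  "sub_hypergraph V' E' V E \<longleftrightarrow> V' \<subseteq> V \<and> E' \<subseteq> E \<and> (\<forall>e\<in>E'. e \<subseteq> V')"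

text \<open>The disjoint union of vertices and hyperedges is formed in a sum type, and the edge
  \<open>v \<sim> e\<close> is the pair \<open>(v, e)\<close>.\<close>

definition incidence_graph ::
  "'v set \<Rightarrow> 'v set set \<Rightarrow> ('v + 'v set, 'v \<times> 'v set) graph" where
  "incidence_graph V E =
     \<lparr>gverts = Inl ` V \<union> Inr ` E,
      gedges = {(v, e). v \<in> V \<and> e \<in> E \<and> v \<in> e},
      gends = (\<lambda>(v, e). {Inl v, Inr e})\<rparr>"

text \<open>The intersection is taken inside the ambient space, so the empty one is the whole space.\<close>

definition inter_space :: "'m rvs \<Rightarrow> ('v \<Rightarrow> 'm set) \<Rightarrow> 'v set \<Rightarrow> 'm set" where
  "inter_space VV S A = carrier VV \<inter> (\<Inter>v\<in>A. S v)"

fun motion_space :: "'m rvs \<Rightarrow> ('v \<Rightarrow> 'm set) \<Rightarrow> 'v + 'v set \<Rightarrow> 'm set" where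
  "motion_space VV S (Inl v) = S v"
| "motion_space VV S (Inr e) = inter_space VV S e"

text \<open>For a hyperedge \<open>e\<close> containing \<open>v\<close>, reduction modulo \<open>S v\<close> sends the coset
  \<open>S(e) + W\<close> to \<open>(S(e) + W) + S v = S v + W\<close>.\<close>

definition motion_sheaf ::
  "'m rvs \<Rightarrow> ('v \<Rightarrow> 'm set) \<Rightarrow> ('v + 'v set, 'v \<times> 'v set, 'm set) sheaf" where
  "motion_sheaf VV S =
     \<lparr>vstalk = (\<lambda>x. quot_vs VV (motion_space VV S x)),
      estalk = (\<lambda>(v, e). quot_vs VV (S v)),
      restr = (\<lambda>x (v, e) C. case x of Inl _ \<Rightarrow> C | Inr _ \<Rightarrow> C <+>\<^bsub>VV\<^esub> S v)\<rparr>"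

definition motion_independent ::
  "'v set \<Rightarrow> 'v set set \<Rightarrow> ('v + 'v set \<Rightarrow> 'v \<times> 'v set \<Rightarrow> real) \<Rightarrow>
   'm rvs \<Rightarrow> ('v \<Rightarrow> 'm set) \<Rightarrow> bool" where
  "motion_independent V E \<sigma> VV S \<longleftrightarrow>
     independent_sheaf (incidence_graph V E) \<sigma> (motion_sheaf VV S)"

definition motion_rigid ::
  "'v set \<Rightarrow> 'v set set \<Rightarrow> ('v + 'v set \<Rightarrow> 'v \<times> 'v set \<Rightarrow> real) \<Rightarrow>
   'm rvs \<Rightarrow> ('v \<Rightarrow> 'm set) \<Rightarrow> bool" where
  "motion_rigid V E \<sigma> VV S \<longleftrightarrow>
     graph_connected (incidence_graph V E) \<and>
     (\<forall>w \<in> carrier (cohomology0 (incidence_graph V E) \<sigma> (motion_sheaf VV S)).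
        \<exists>W \<in> carrier VV.
          w = (\<lambda>x \<in> gverts (incidence_graph V E). motion_space VV S x +>\<^bsub>VV\<^esub> W))"

definition motion_minimally_rigid ::
  "'v set \<Rightarrow> 'v set set \<Rightarrow> ('v + 'v set \<Rightarrow> 'v \<times> 'v set \<Rightarrow> real) \<Rightarrow>
   'm rvs \<Rightarrow> ('v \<Rightarrow> 'm set) \<Rightarrow> bool" where
  "motion_minimally_rigid V E \<sigma> VV S \<longleftrightarrow>
     motion_independent V E \<sigma> VV S \<and> motion_rigid V E \<sigma> VV S"

section \<open>Well-definedness\<close>

lemma incidence_graph_simple:
  assumes "finite_hypergraph V E"
  shows "simple_graph (incidence_graph V E)"
  by (auto simp: simple_graph_def incidence_graph_def inj_on_def doubleton_eq_iff)

lemma subspace_abelian_subgroup: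
  assumes "VectorSpace.subspace class_ring N (M :: 'm rvs)"
  shows "abelian_subgroup N M"
proof -
  interpret vectorspace class_ring M using assms by (simp add: subspace_def)
  interpret N: submodule class_ring N M using assms by (simp add: subspace_def)
  have neg: "\<ominus>\<^bsub>M\<^esub> x \<in> N" if "x \<in> N" for x
  proof -
    have xc: "x \<in> carrier M" using N.subset that by auto
    have "(\<ominus>\<^bsub>class_ring\<^esub> (1::real)) \<odot>\<^bsub>M\<^esub> x = \<ominus>\<^bsub>M\<^esub> (1 \<odot>\<^bsub>M\<^esub> x)"
      using xc by (intro smult_l_minus) auto
    also have "1 \<odot>\<^bsub>M\<^esub> x = x" using xc smult_one by simp
    finally show ?thesis using N.smult_closed[of "\<ominus>\<^bsub>class_ring\<^esub> 1" x] that
      by simp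
  qed
  have "subgroup N (add_monoid M)"
  proof (rule add.subgroupI)
    show "N \<noteq> {}" using N.zero_closed by blast
  qed (use N.subset neg in \<open>auto simp: a_inv_def[symmetric]\<close>)
  then have "additive_subgroup N M" by (rule additive_subgroup.intro)
  then show ?thesis by (intro abelian_subgroupI3 abelian_group_axioms)
qed

lemma quot_vs_smult_coset:
  assumes "VectorSpace.subspace class_ring N (M :: 'm rvs)" "u \<in> carrier M"
  shows "a \<odot>\<^bsub>quot_vs M N\<^esub> (N +>\<^bsub>M\<^esub> u) = N +>\<^bsub>M\<^esub> (a \<odot>\<^bsub>M\<^esub> u)"
proof -
  interpret vectorspace class_ring M using assms by (simp add: subspace_def)
  interpret sub: submodule class_ring N M using assms by (simp add: subspace_def)
  interpret abelian_subgroup N M using assms(1) by (rule subspace_abelian_subgroup)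
  have "N +>\<^bsub>M\<^esub> (a \<odot>\<^bsub>M\<^esub> x) = N +>\<^bsub>M\<^esub> (a \<odot>\<^bsub>M\<^esub> u)" if x: "x \<in> N +>\<^bsub>M\<^esub> u" for x
  proof -
    obtain n where n: "n \<in> N" "x = n \<oplus>\<^bsub>M\<^esub> u" using x by (auto simp: a_r_coset_def')
    have nc: "n \<in> carrier M" using n sub.subset by auto
    have "a \<odot>\<^bsub>M\<^esub> x = (a \<odot>\<^bsub>M\<^esub> n) \<oplus>\<^bsub>M\<^esub> (a \<odot>\<^bsub>M\<^esub> u)"
      using n(2) nc assms(2) by (simp add: smult_r_distr)
    then have "a \<odot>\<^bsub>M\<^esub> x \<in> N +>\<^bsub>M\<^esub> (a \<odot>\<^bsub>M\<^esub> u)"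
      using n sub.smult_closed[of a n] by (auto simp: a_r_coset_def')
    then show ?thesis using assms(2) by (intro a_repr_independence'[symmetric]) auto
  qed
  moreover have "N +>\<^bsub>M\<^esub> u \<noteq> {}" using sub.zero_closed unfolding a_r_coset_def' by blast
  ultimately show ?thesis by (auto simp: quot_vs_def)
qed

lemma quot_vs_vectorspace:
  assumes sub: "VectorSpace.subspace class_ring N (M :: 'm rvs)"
  shows "real_vs (quot_vs M N)"
proof -
  interpret vectorspace class_ring M using assms by (simp add: subspace_def)
  interpret abelian_subgroup N M using assms(1) by (rule subspace_abelian_subgroup)
  let ?q = "\<lambda>u. N +>\<^bsub>M\<^esub> u"
  have car: "carrier (quot_vs M N) = ?q ` carrier M"
    by (auto simp: quot_vs_def A_RCOSETS_def')
  have zero: "\<zero>\<^bsub>quot_vs M N\<^esub> = ?q \<zero>\<^bsub>M\<^esub>"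
    using a_subset by (simp add: quot_vs_def)
  have add: "?q u \<oplus>\<^bsub>quot_vs M N\<^esub> ?q v = ?q (u \<oplus>\<^bsub>M\<^esub> v)" if "u \<in> carrier M" "v \<in> carrier M" for u v
    using that by (simp add: quot_vs_def a_rcos_sum)
  note smult = quot_vs_smult_coset[OF sub]
  have cl: "a \<odot>\<^bsub>M\<^esub> u \<in> carrier M" if "u \<in> carrier M" for a u using that smult_closed by auto
  have neg: "\<exists>w\<in>carrier M. ?q u \<oplus>\<^bsub>quot_vs M N\<^esub> ?q w = \<zero>\<^bsub>quot_vs M N\<^esub>" if "u \<in> carrier M" for u
    using that by (intro bexI[of _ "\<ominus>\<^bsub>M\<^esub> u"]) (simp_all add: add zero r_neg)
  have "Module.module class_ring (quot_vs M N)"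
  proof (rule module_criteria, goal_cases)
    case 4 then show ?case using neg unfolding car by auto
  qed (use class_cring.cring_axioms smult_assoc1 smult_one smult_l_distr smult_r_distr in
      \<open>auto simp: car zero add smult cl a_ac\<close>)
  then show ?thesis by (intro vectorspace.intro class_field.field_axioms)
qed

lemma prod_vs_vectorspace:
  assumes vs: "\<And>j. j \<in> J \<Longrightarrow> real_vs (M j :: 'm rvs)"
  shows "real_vs (prod_vs J M)"
proof -
  have md: "Module.module class_ring (M j)" if "j \<in> J" for j
    using vs[OF that] by (simp add: vectorspace_def)
  have ag: "abelian_group (M j)" if "j \<in> J" for j
    using md[OF that] by (simp add: Module.module_def)
  have am: "abelian_monoid (M j)" if "j \<in> J" for j
    using ag[OF that] by (simp add: abelian_group_def)
  note [simp] = abelian_monoid.zero_closed[OF am] abelian_monoid.a_closed[OF am]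
    abelian_monoid.r_zero[OF am] abelian_group.r_neg[OF ag] abelian_group.a_inv_closed[OF ag]
  have sm[simp]: "a \<odot>\<^bsub>M j\<^esub> x \<in> carrier (M j)" if "j \<in> J" "x \<in> carrier (M j)" for a j x
    using Module.module.smult_closed[OF md[OF that(1)], of a x] that by simp
  have "Module.module class_ring (prod_vs J M)"
  proof (rule module_criteria, goal_cases)
    case 1 show ?case by (rule class_cring.cring_axioms)
  next
    case 4 show ?case
    proof
      fix v assume "v \<in> carrier (prod_vs J M)"
      then show "\<exists>w\<in>carrier (prod_vs J M). v \<oplus>\<^bsub>prod_vs J M\<^esub> w = \<zero>\<^bsub>prod_vs J M\<^esub>"
        by (intro bexI[of _ "\<lambda>j\<in>J. \<ominus>\<^bsub>M j\<^esub> v j"]) (auto simp: prod_vs_def PiE_def Pi_def intro!: restrict_ext)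
    qed
  next
    case 6 show ?case
      by (auto simp: prod_vs_def PiE_def Pi_def intro!: restrict_ext abelian_monoid.a_comm[OF am])
  next
    case 7 show ?case
      by (auto simp: prod_vs_def PiE_def Pi_def intro!: restrict_ext abelian_monoid.a_assoc[OF am])
  next
    case 8 show ?case
      by (auto simp: prod_vs_def PiE_def Pi_def extensional_def restrict_def fun_eq_iff)
  next
    case 9 show ?case
      using Module.module.smult_assoc1[OF md]
      by (auto simp: prod_vs_def PiE_def Pi_def intro!: restrict_ext)
  next
    case 10 show ?case
      using Module.module.smult_one[OF md]
      by (auto simp: prod_vs_def PiE_def Pi_def extensional_def restrict_def fun_eq_iff)
  next
    case 11 show ?case
      using Module.module.smult_l_distr[OF md]
      by (auto simp: prod_vs_def PiE_def Pi_def intro!: restrict_ext)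
  next
    case 12 show ?case
      using Module.module.smult_r_distr[OF md]
      by (auto simp: prod_vs_def PiE_def Pi_def intro!: restrict_ext)
  qed (auto simp: prod_vs_def PiE_def Pi_def)
  then show ?thesis by (intro vectorspace.intro class_field.field_axioms)
qed

lemma subspace_inter_space:
  assumes "real_vs (VV :: 'm rvs)" "\<And>v. v \<in> A \<Longrightarrow> VectorSpace.subspace class_ring (S v) VV"
  shows "VectorSpace.subspace class_ring (inter_space VV S A) VV"
proof -
  interpret vectorspace class_ring VV by fact
  have sub: "submodule class_ring (S v) VV" if "v \<in> A" for v
    using assms(2)[OF that] by (simp add: subspace_def)
  have "submodule class_ring (inter_space VV S A) VV"
    using submodule.m_closed[OF sub] submodule.zero_closed[OF sub] submodule.smult_closed[OF sub]
      smult_closed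
    by (intro submodule.intro module_axioms) (auto simp: inter_space_def)
  then show ?thesis using assms(1) by (intro subspace.intro)
qed

lemma coset_reduce:
  assumes "VectorSpace.subspace class_ring N (M :: 'm rvs)"
    "VectorSpace.subspace class_ring N' M" "N \<subseteq> N'" "u \<in> carrier M"
  shows "(N +>\<^bsub>M\<^esub> u) <+>\<^bsub>M\<^esub> N' = N' +>\<^bsub>M\<^esub> u"
proof -
  interpret vectorspace class_ring M using assms by (simp add: subspace_def)
  interpret N: submodule class_ring N M using assms by (simp add: subspace_def)
  interpret N': submodule class_ring N' M using assms by (simp add: subspace_def)
  have "\<exists>h\<in>N'. (n \<oplus>\<^bsub>M\<^esub> u) \<oplus>\<^bsub>M\<^esub> n' = h \<oplus>\<^bsub>M\<^esub> u" if "n \<in> N" "n' \<in> N'" for n n'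
  proof -
    have "n \<in> carrier M" "n' \<in> carrier M" "n \<in> N'"
      using that N.subset N'.subset assms(3) by auto
    then show ?thesis
      using that assms(4) by (intro bexI[of _ "n \<oplus>\<^bsub>M\<^esub> n'"]) (auto simp: a_ac)
  qed
  moreover have "\<exists>n\<in>N. \<exists>n'\<in>N'. h \<oplus>\<^bsub>M\<^esub> u = (n \<oplus>\<^bsub>M\<^esub> u) \<oplus>\<^bsub>M\<^esub> n'" if "h \<in> N'" for h
  proof -
    have "h \<in> carrier M" using that N'.subset by auto
    then show ?thesis
      using that assms(4) by (intro bexI[of _ "\<zero>\<^bsub>M\<^esub>"] bexI[of _ h]) (auto simp: a_ac)
  qed
  ultimately show ?thesis by (auto simp: a_r_coset_def' set_add_def')
qed

lemma motion_sheaf_is_sheaf: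
  assumes hyp: "finite_hypergraph V E" and vs: "real_vs (VV :: 'm rvs)"
    and S: "\<And>v. v \<in> V \<Longrightarrow> VectorSpace.subspace class_ring (S v) VV"
  shows "sheaf_on (incidence_graph V E) (motion_sheaf VV S)"
proof -
  interpret vectorspace class_ring VV by fact
  have me: "VectorSpace.subspace class_ring (inter_space VV S e) VV" if "e \<in> E" for e
    using hyp that S by (intro subspace_inter_space vs) (auto simp: finite_hypergraph_def)
  have hom: "(\<lambda>C. C <+>\<^bsub>VV\<^esub> S v) \<in> LinearCombinations.module_hom class_ring
      (quot_vs VV (inter_space VV S e)) (quot_vs VV (S v))"
    if ve: "v \<in> V" "e \<in> E" "v \<in> e" for v e
  proof -
    have sub: "inter_space VV S e \<subseteq> S v" using ve by (auto simp: inter_space_def)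
    note red = coset_reduce[OF me[OF ve(2)] S[OF ve(1)] sub]
    interpret N: abelian_subgroup "inter_space VV S e" VV
      by (rule subspace_abelian_subgroup[OF me[OF ve(2)]])
    interpret N': abelian_subgroup "S v" VV
      by (rule subspace_abelian_subgroup[OF S[OF ve(1)]])
    have cl: "a \<odot>\<^bsub>VV\<^esub> u \<in> carrier VV" if "u \<in> carrier VV" for a u
      using that smult_closed by auto
    have 1: "carrier (quot_vs VV N) = (\<lambda>u. N +>\<^bsub>VV\<^esub> u) ` carrier VV" for N
      by (auto simp: quot_vs_def A_RCOSETS_def')
    have 2: "A \<oplus>\<^bsub>quot_vs VV N\<^esub> B = A <+>\<^bsub>VV\<^esub> B" for A B N
      by (simp add: quot_vs_def)
    show ?thesis
      by (auto simp: LinearCombinations.module_hom_def 1 2 red N.a_rcos_sum N'.a_rcos_sum cl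
          quot_vs_smult_coset[OF me[OF ve(2)]] quot_vs_smult_coset[OF S[OF ve(1)]])
  qed
  have idh: "(\<lambda>C. C) \<in> LinearCombinations.module_hom class_ring Q Q" for Q :: "'m set rvs"
    by (auto simp: LinearCombinations.module_hom_def)
  show ?thesis
    using hom me S idh
    by (auto simp: sheaf_on_def incidence_graph_def motion_sheaf_def intro!: quot_vs_vectorspace)
qed

end

(* The coboundary value at an incidence (v, e) only depends on the two stalks at v and e, so
   surjectivity of the coboundary passes from the whole incidence graph to that of any
   sub-hypergraph: extend a 1-cochain by zero, lift it, and restrict the lift. Rank-nullity then
   expresses dim H^0 of the sub-hypergraph as dim C^0 - dim C^1, which is the difference of the two
   sides of the inequality plus dim VV. The diagonal map VV -> H^0 is injective because the S_v have
   trivial intersection, and rigidity says that it is onto. *)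

theory Submission
  imports Defs
begin

section \<open>Dimensions under linear maps, in short exact sequences and of finite products\<close>

lemma linear_mapI:
  assumes "vectorspace K V" "vectorspace K W" "\<And>v. v \<in> carrier V \<Longrightarrow> T v \<in> carrier W"
    and "\<And>u v. u \<in> carrier V \<Longrightarrow> v \<in> carrier V \<Longrightarrow> T (u \<oplus>\<^bsub>V\<^esub> v) = T u \<oplus>\<^bsub>W\<^esub> T v"
    and "\<And>a v. a \<in> carrier K \<Longrightarrow> v \<in> carrier V \<Longrightarrow> T (a \<odot>\<^bsub>V\<^esub> v) = a \<odot>\<^bsub>W\<^esub> T v"
  shows "linear_map K V W T"
  using assms
  by (auto simp: linear_map_def mod_hom_def mod_hom_axioms_def vectorspace_def
      LinearCombinations.module_hom_def)

text \<open>Sets independent in \<open>W\<close> stay independent in the ambient space, so their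
  size is at most \<open>dim\<close>. Hence a maximal one exists, and it is a finite basis of
  \<open>W\<close>.\<close>

lemma (in vectorspace) subspace_dim_le:
  assumes fd: fin_dim and W: "VectorSpace.subspace K W V"
  shows "vectorspace.fin_dim K (vs W)" "vectorspace.dim K (vs W) \<le> dim"
proof -
  interpret W: vectorspace K "vs W" using W by (rule subspace_is_vs)
  have sub: "submodule K W V" using W by (rule is_module)
  note WC = submodule.subset[OF sub]
  have li: "finite A \<and> card A \<le> dim" if "A \<subseteq> carrier (vs W) \<and> W.lin_indpt A" for A
    using that WC li_le_dim[OF fd, of A] span_li_not_depend(2)[OF _ sub, of A] by auto
  have "W.lin_indpt {}" by (auto simp: W.lin_dep_def)
  then obtain A where A: "finite A" "maximal A (\<lambda>S. S \<subseteq> carrier (vs W) \<and> W.lin_indpt S)"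
    using maximal_exists[where P = "\<lambda>S. S \<subseteq> carrier (vs W) \<and> W.lin_indpt S", OF li, of "{}"]
    by auto
  have B: "W.basis A" by (rule W.max_li_is_basis[OF A(2)])
  then show "W.fin_dim" using A(1) by (auto simp: W.fin_dim_def W.basis_def)
  show "W.dim \<le> dim"
    using W.dim_basis[OF A(1) B] li[of A] B by (simp add: W.basis_def)
qed

context linear_map
begin

text \<open>With zero kernel, rank-nullity makes \<open>V.dim\<close> the dimension of the image,
  which is a subspace of the target.\<close>

lemma inj_dim_le:
  assumes "V.fin_dim" "W.fin_dim" "inj_on T (carrier V)"
  shows "V.dim \<le> W.dim"
  using rank_nullity[OF assms(1)] inj_imp_dim_ker0[OF assms(3)]
    W.subspace_dim_le(2)[OF assms(2) imT_is_subspace] by simp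

lemma rank_nullity_surj:
  assumes "V.fin_dim" "T ` carrier V = carrier W"
  shows "W.dim + vectorspace.dim K (V.vs kerT) = V.dim"
  using rank_nullity[OF assms(1)] surj_imp_imT_carrier[OF assms(2)] by simp

text \<open>Finite generators of the kernel, together with lifts of finite generators of the target,
  generate the source. This supplies the finite dimension of the source that rank-nullity
  presupposes.\<close>

lemma fin_dim_extension:
  assumes ker: "vectorspace.fin_dim K (V.vs kerT)" and W: "W.fin_dim"
    and surj: "T ` carrier V = carrier W"
  shows "V.fin_dim"
proof -
  interpret Ker: vectorspace K "V.vs kerT"
    by (rule V.subspace_is_vs[OF kerT_is_subspace])
  have sub: "submodule K kerT V" by (rule V.is_module[OF kerT_is_subspace])
  obtain A where A: "finite A" "A \<subseteq> kerT" "V.module.span A = kerT"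
    using ker V.module.span_li_not_depend(1)[OF _ sub] by (auto simp: Ker.fin_dim_def)
  obtain B where B: "finite B" "B \<subseteq> carrier W" "W.module.span B = carrier W"
    using W by (auto simp: W.fin_dim_def)
  have "\<forall>b\<in>B. \<exists>v\<in>carrier V. T v = b" using B(2) surj by (metis image_iff subsetD)
  then obtain g where g: "\<And>b. b \<in> B \<Longrightarrow> g b \<in> carrier V \<and> T (g b) = b" by metis
  define U where "U = A \<union> g ` B"
  have UC: "U \<subseteq> carrier V" using A(2) g by (auto simp: U_def ker_def)
  interpret U: submodule K "V.module.span U" V by (rule V.module.span_is_submodule[OF UC])
  \<comment> \<open>Being a submodule, the image of the span contains all of
    \<open>carrier W\<close> as soon as it contains the generators \<open>B\<close>.\<close>
  have "submodule K (T ` V.module.span U) W"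
  proof (rule submodule.intro)
    fix v w assume "v \<in> T ` V.module.span U" "w \<in> T ` V.module.span U"
    then obtain x y where xy: "x \<in> V.module.span U" "y \<in> V.module.span U"
      and vw: "v = T x" "w = T y" by blast
    have "v \<oplus>\<^bsub>W\<^esub> w = T (x \<oplus>\<^bsub>V\<^esub> y)"
      unfolding vw using U.subset xy by (intro T_add[symmetric]) (rule subsetD, assumption+)+
    then show "v \<oplus>\<^bsub>W\<^esub> w \<in> T ` V.module.span U"
      using U.m_closed[OF xy] by (rule image_eqI)
  next
    fix c v assume c: "c \<in> carrier K" and "v \<in> T ` V.module.span U"
    then obtain x where x: "x \<in> V.module.span U" "v = T x" by blast
    have "c \<odot>\<^bsub>W\<^esub> v = T (c \<odot>\<^bsub>V\<^esub> x)"
      unfolding x(2) using c subsetD[OF U.subset x(1)] by (rule T_smult[symmetric])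
    then show "c \<odot>\<^bsub>W\<^esub> v \<in> T ` V.module.span U"
      using U.smult_closed[OF c x(1)] by (rule image_eqI)
  next
    show "\<zero>\<^bsub>W\<^esub> \<in> T ` V.module.span U" using U.zero_closed f0_is_0 by (metis imageI)
  qed (use U.subset in \<open>auto intro: W.module.module_axioms\<close>)
  moreover have "B \<subseteq> T ` V.module.span U"
    using g V.module.in_own_span[OF UC] by (force simp: U_def)
  ultimately have im: "carrier W \<subseteq> T ` V.module.span U"
    using B(3) W.module.span_is_subset by metis
  \<comment> \<open>Choose \<open>u\<close> in the span with the same image as \<open>v\<close>.
    Then the difference lies in the kernel, which is spanned by \<open>A\<close>, and adding
    \<open>u\<close> back recovers \<open>v\<close>.\<close>
  have "v \<in> V.module.span U" if v: "v \<in> carrier V" for v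
  proof -
    obtain u where u: "u \<in> V.module.span U" "T v = T u" using im v by (metis T_im imageE subsetD)
    then have uc: "u \<in> carrier V" using U.subset by auto
    have "T (v \<ominus>\<^bsub>V\<^esub> u) = T v \<ominus>\<^bsub>W\<^esub> T u" using v uc by (rule T_minus)
    also have "\<dots> = \<zero>\<^bsub>W\<^esub>"
      using T_im[OF uc] by (simp add: u(2) a_minus_def W.module.M.r_neg)
    finally have "T (v \<ominus>\<^bsub>V\<^esub> u) = \<zero>\<^bsub>W\<^esub>" .
    then have "v \<ominus>\<^bsub>V\<^esub> u \<in> V.module.span A" using v uc A(3) by (simp add: ker_def)
    then have "v \<ominus>\<^bsub>V\<^esub> u \<in> V.module.span U"
      using V.module.span_is_monotone[of A U] by (auto simp: U_def)
    then have "(v \<ominus>\<^bsub>V\<^esub> u) \<oplus>\<^bsub>V\<^esub> u \<in> V.module.span U" using u(1) by (rule U.m_closed)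
    also have "(v \<ominus>\<^bsub>V\<^esub> u) \<oplus>\<^bsub>V\<^esub> u = v"
      using v uc by (simp add: a_minus_def V.module.M.a_assoc V.module.M.l_neg)
    finally show ?thesis .
  qed
  then have "V.module.gen_set U" using U.subset by auto
  moreover have "finite U" using A(1) B(1) by (simp add: U_def)
  ultimately show ?thesis unfolding V.fin_dim_def using UC by blast
qed

end

text \<open>Exactness identifies \<open>A\<close> with the kernel of \<open>p\<close>, so additivity
  is rank-nullity for \<open>p\<close>. Finite dimension of the middle term is a conclusion, which
  makes the lemma usable in an induction.\<close>

lemma short_exact_dim:
  assumes i: "linear_map K A B i" "inj_on i (carrier A)"
    and p: "linear_map K B C p" "p ` carrier B = carrier C"
    and exact: "i ` carrier A = {b \<in> carrier B. p b = \<zero>\<^bsub>C\<^esub>}"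
    and fd: "vectorspace.fin_dim K A" "vectorspace.fin_dim K C"
  shows "vectorspace.fin_dim K B"
    "vectorspace.dim K B = vectorspace.dim K A + vectorspace.dim K C"
proof -
  interpret i: linear_map K A B i by (rule i(1))
  interpret p: linear_map K B C p by (rule p(1))
  have A: "vectorspace K A" and B: "vectorspace K B" using i(1) by (simp_all add: linear_map_def)
  have ker: "p.kerT = i ` carrier A" by (simp add: p.ker_def exact)
  interpret Ker: vectorspace K "B\<lparr>carrier := p.kerT\<rparr>"
    by (rule vectorspace.subspace_is_vs[OF B p.kerT_is_subspace])
  \<comment> \<open>Corestricting \<open>i\<close> to the kernel turns it into a bijective linear
    map, which transfers both finiteness and dimension.\<close>
  interpret ik: linear_map K A "B\<lparr>carrier := p.kerT\<rparr>" i
    by (rule linear_mapI[OF A Ker.vectorspace_axioms]) (auto simp: ker)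
  have im: "i ` carrier A = carrier (B\<lparr>carrier := p.kerT\<rparr>)" by (simp add: ker)
  show fdB: "vectorspace.fin_dim K B"
    by (rule p.fin_dim_extension[OF ik.surj_fin_dim[OF fd(1) im] fd(2) p(2)])
  show "vectorspace.dim K B = vectorspace.dim K A + vectorspace.dim K C"
    using p.rank_nullity_surj[OF fdB p(2)] ik.dim_eq[OF fd(1) i(2) im] by simp
qed

text \<open>Induction on \<open>J\<close>: extension by zero at \<open>j\<close> and evaluation at
  \<open>j\<close> form a short exact sequence from the product over \<open>J\<close>, through the
  product over \<open>insert j J\<close>, to \<open>M j\<close>.\<close>

lemma prod_vs_dim:
  assumes "finite J" "\<And>j. j \<in> J \<Longrightarrow> real_vs (M j :: 'm rvs)"
    and "\<And>j. j \<in> J \<Longrightarrow> vectorspace.fin_dim class_ring (M j)"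
  shows "vectorspace.fin_dim class_ring (prod_vs J M) \<and>
    rdim (prod_vs J M) = (\<Sum>j\<in>J. rdim (M j))"
  using assms
proof (induction J rule: finite_induct)
  case empty
  interpret P: vectorspace class_ring "prod_vs {} M" by (rule prod_vs_vectorspace) simp
  \<comment> \<open>The empty product has a single element, the function that is
    \<open>undefined\<close> everywhere, and this is its zero.\<close>
  have gen: "P.gen_set {}" by (simp add: P.span_empty) (auto simp: prod_vs_def)
  then have "P.basis {}" by (auto simp: P.basis_def P.lin_dep_def)
  then show ?case using gen P.dim_basis[of "{}"] by (auto simp: P.fin_dim_def)
next
  case (insert j J)
  interpret P: vectorspace class_ring "prod_vs J M"
    by (rule prod_vs_vectorspace) (simp add: insert.prems)
  interpret Q: vectorspace class_ring "prod_vs (insert j J) M"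
    by (rule prod_vs_vectorspace) (simp add: insert.prems)
  interpret Mj: vectorspace class_ring "M j" by (simp add: insert.prems)
  let ?i = "\<lambda>f. f(j := \<zero>\<^bsub>M j\<^esub>)" and ?p = "\<lambda>f. f j"
  have i: "linear_map class_ring (prod_vs J M) (prod_vs (insert j J) M) ?i"
  proof (rule linear_mapI[OF P.vectorspace_axioms Q.vectorspace_axioms])
    fix f assume "f \<in> carrier (prod_vs J M)"
    then show "?i f \<in> carrier (prod_vs (insert j J) M)"
      by (auto simp: prod_vs_def PiE_def Pi_def extensional_def)
  next
    fix a f
    show "?i (a \<odot>\<^bsub>prod_vs J M\<^esub> f) = a \<odot>\<^bsub>prod_vs (insert j J) M\<^esub> ?i f"
      using insert.hyps(2) Mj.smult_r_null[of a] by (auto simp: prod_vs_def fun_eq_iff)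
  qed (use insert.hyps(2) in \<open>auto simp: prod_vs_def fun_eq_iff\<close>)
  have p: "linear_map class_ring (prod_vs (insert j J) M) (M j) ?p"
    by (rule linear_mapI[OF Q.vectorspace_axioms Mj.vectorspace_axioms]) (auto simp: prod_vs_def)
  \<comment> \<open>All elements of the product over \<open>J\<close> take the value
    \<open>undefined\<close> at \<open>j\<close>, so overwriting that value loses no
    information.\<close>
  have inj: "inj_on ?i (carrier (prod_vs J M))"
    using insert.hyps(2)
    by (auto simp: prod_vs_def inj_on_def PiE_def extensional_def fun_eq_iff) metis
  have surj: "?p ` carrier (prod_vs (insert j J) M) = carrier (M j)"
  proof (intro equalityI subsetI)
    fix m assume "m \<in> carrier (M j)"
    then have "\<zero>\<^bsub>prod_vs (insert j J) M\<^esub>(j := m) \<in> carrier (prod_vs (insert j J) M)"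
      using Q.zero_closed by (auto simp: prod_vs_def PiE_def Pi_def extensional_def)
    then show "m \<in> ?p ` carrier (prod_vs (insert j J) M)" by (rule rev_image_eqI) simp
  qed (auto simp: prod_vs_def)
  have exact: "?i ` carrier (prod_vs J M) =
      {f \<in> carrier (prod_vs (insert j J) M). ?p f = \<zero>\<^bsub>M j\<^esub>}"
  proof (intro equalityI subsetI)
    fix f assume f: "f \<in> {f \<in> carrier (prod_vs (insert j J) M). ?p f = \<zero>\<^bsub>M j\<^esub>}"
    \<comment> \<open>The preimage must be extensional on \<open>J\<close>, hence the value
      \<open>undefined\<close> at \<open>j\<close> where \<open>f\<close> has zero.\<close>
    then have "f(j := undefined) \<in> carrier (prod_vs J M)"
      using insert.hyps(2) by (auto simp: prod_vs_def PiE_def Pi_def extensional_def)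
    then show "f \<in> ?i ` carrier (prod_vs J M)"
      by (rule rev_image_eqI) (use f in auto)
  qed (use linear_map.T_im[OF i] in auto)
  note ex = short_exact_dim[OF i inj p surj exact]
  show ?case using ex insert by simp
qed

section \<open>Quotient spaces\<close>

lemma coset_linear:
  assumes sub: "VectorSpace.subspace class_ring N (M :: 'm rvs)"
  shows "linear_map class_ring M (quot_vs M N) (\<lambda>u. N +>\<^bsub>M\<^esub> u)"
proof -
  interpret abelian_subgroup N M using sub by (rule subspace_abelian_subgroup)
  have M: "real_vs M" using sub by (simp add: subspace_def)
  show ?thesis
    by (rule linear_mapI[OF M quot_vs_vectorspace[OF sub]])
      (auto simp: quot_vs_smult_coset[OF sub], auto simp: quot_vs_def A_RCOSETS_def' a_rcos_sum)
qed

lemma carrier_quot_vs: "carrier (quot_vs M N) = (\<lambda>u. N +>\<^bsub>M\<^esub> u) ` carrier M"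
  by (auto simp: quot_vs_def A_RCOSETS_def')

lemma quot_vs_fin_dim:
  assumes sub: "VectorSpace.subspace class_ring N (M :: 'm rvs)"
    and "vectorspace.fin_dim class_ring M"
  shows "vectorspace.fin_dim class_ring (quot_vs M N)"
  by (rule linear_map.surj_fin_dim[OF coset_linear[OF sub] assms(2)]) (simp add: carrier_quot_vs)

text \<open>Each \<open>x\<close> lies in its own coset; if \<open>N\<close> is the only coset, then
  \<open>x\<close> lies in \<open>N\<close>. This is how vanishing of H^1 becomes surjectivity of
  the coboundary.\<close>

lemma quot_vs_trivialD:
  assumes sub: "VectorSpace.subspace class_ring N (M :: 'm rvs)"
    and triv: "carrier (quot_vs M N) = {\<zero>\<^bsub>quot_vs M N\<^esub>}"
  shows "N = carrier M"
proof -
  interpret abelian_subgroup N M using sub by (rule subspace_abelian_subgroup)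
  have "x \<in> N" if "x \<in> carrier M" for x
  proof -
    have "N +>\<^bsub>M\<^esub> x \<in> carrier (quot_vs M N)" using that by (simp add: carrier_quot_vs)
    then have "N +>\<^bsub>M\<^esub> x = N" unfolding triv by (simp add: quot_vs_def)
    then show ?thesis using a_rcos_self[OF that] by simp
  qed
  then show ?thesis using a_subset by auto
qed

section \<open>The cochain complex of a cellular sheaf on a graph\<close>

context
  fixes G :: "('x, 'i) graph" and F :: "('x, 'i, 'm) sheaf" and \<sigma> :: "'x \<Rightarrow> 'i \<Rightarrow> real"
  assumes G: "simple_graph G" and F: "sheaf_on G F"
begin

lemma cochain_vectorspace: "real_vs (cochain0 G F)" "real_vs (cochain1 G F)"
  using F by (auto simp: cochain0_def cochain1_def sheaf_on_def intro: prod_vs_vectorspace)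

lemma restr_closed:
  assumes "i \<in> gedges G" "x \<in> gends G i" "w \<in> carrier (cochain0 G F)"
  shows "restr F x i (w x) \<in> carrier (estalk F i)"
proof -
  have "restr F x i \<in> LinearCombinations.module_hom class_ring (vstalk F x) (estalk F i)"
    using F assms by (simp add: sheaf_on_def)
  moreover have "w x \<in> carrier (vstalk F x)"
    using G assms by (auto simp: simple_graph_def cochain0_def prod_vs_def)
  ultimately show ?thesis by (auto dest: LinearCombinations.module_hom_closed)
qed

text \<open>Each coordinate is a sum of scaled restriction maps, so linearity can be checked edge by
  edge.\<close>

lemma coboundary_linear:
  "linear_map class_ring (cochain0 G F) (cochain1 G F) (coboundary G \<sigma> F)"
proof -
  define t where "t w i x = \<sigma> x i \<odot>\<^bsub>estalk F i\<^esub> restr F x i (w x)" for w i x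
  define L where "L w i = finsum (estalk F i) (t w i) (gends G i)" for w i
  have L: "coboundary G \<sigma> F w = (\<lambda>i\<in>gedges G. L w i)" for w
    by (simp add: coboundary_def L_def t_def[abs_def])
  have L_im: "L w i \<in> carrier (estalk F i)"
    and L_add: "u \<in> carrier (cochain0 G F) \<Longrightarrow>
      L (u \<oplus>\<^bsub>cochain0 G F\<^esub> w) i = L u i \<oplus>\<^bsub>estalk F i\<^esub> L w i"
    and L_smult: "L (a \<odot>\<^bsub>cochain0 G F\<^esub> w) i = a \<odot>\<^bsub>estalk F i\<^esub> L w i"
    if i: "i \<in> gedges G" and w: "w \<in> carrier (cochain0 G F)"
    for w i a u
  proof -
    interpret E: vectorspace class_ring "estalk F i" using F i by (simp add: sheaf_on_def)
    have mem: "v x \<in> carrier (vstalk F x)" "x \<in> gverts G"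
      if "x \<in> gends G i" "v \<in> carrier (cochain0 G F)" for x v
      using G i that by (auto simp: simple_graph_def cochain0_def prod_vs_def)
    have hom: "restr F x i \<in> LinearCombinations.module_hom class_ring (vstalk F x) (estalk F i)"
      if "x \<in> gends G i" for x
      using F i that by (simp add: sheaf_on_def)
    note r = restr_closed[OF i]
    have t: "t v i \<in> gends G i \<rightarrow> carrier (estalk F i)" if "v \<in> carrier (cochain0 G F)" for v
      using r that by (auto simp: t_def intro!: E.smult_closed)
    show "L w i \<in> carrier (estalk F i)"
      unfolding L_def using t[OF w] by (rule E.finsum_closed)
    show "L (u \<oplus>\<^bsub>cochain0 G F\<^esub> w) i = L u i \<oplus>\<^bsub>estalk F i\<^esub> L w i"
      if u: "u \<in> carrier (cochain0 G F)"
    proof -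
      have "L (u \<oplus>\<^bsub>cochain0 G F\<^esub> w) i =
          finsum (estalk F i) (\<lambda>x. t u i x \<oplus>\<^bsub>estalk F i\<^esub> t w i x) (gends G i)"
        unfolding L_def
      proof (rule E.finsum_cong'[OF refl])
        fix x assume x: "x \<in> gends G i"
        have "restr F x i (u x \<oplus>\<^bsub>vstalk F x\<^esub> w x) = restr F x i (u x) \<oplus>\<^bsub>estalk F i\<^esub> restr F x i (w x)"
          by (rule LinearCombinations.module_hom_add[OF hom[OF x] mem(1)[OF x u] mem(1)[OF x w]])
        then show "t (u \<oplus>\<^bsub>cochain0 G F\<^esub> w) i x = t u i x \<oplus>\<^bsub>estalk F i\<^esub> t w i x"
          using mem(2)[OF x u] r[OF x u] r[OF x w]
          by (simp add: t_def cochain0_def prod_vs_def E.smult_r_distr)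
      qed (use t u w in auto)
      also have "\<dots> = L u i \<oplus>\<^bsub>estalk F i\<^esub> L w i"
        unfolding L_def by (rule E.finsum_addf[OF t[OF u] t[OF w]])
      finally show ?thesis .
    qed
    have "L (a \<odot>\<^bsub>cochain0 G F\<^esub> w) i =
        finsum (estalk F i) (\<lambda>x. a \<odot>\<^bsub>estalk F i\<^esub> t w i x) (gends G i)"
      unfolding L_def
    proof (rule E.finsum_cong'[OF refl])
      fix x assume x: "x \<in> gends G i"
      have "restr F x i (a \<odot>\<^bsub>vstalk F x\<^esub> w x) = a \<odot>\<^bsub>estalk F i\<^esub> restr F x i (w x)"
        by (rule LinearCombinations.module_hom_smult[OF hom[OF x] _ mem(1)[OF x w]]) simp
      \<comment> \<open>The sign and the scalar \<open>a\<close> commute as real numbers, so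
        \<open>a\<close> can be moved outside the sum.\<close>
      moreover have "\<sigma> x i \<odot>\<^bsub>estalk F i\<^esub> (a \<odot>\<^bsub>estalk F i\<^esub> restr F x i (w x)) =
          a \<odot>\<^bsub>estalk F i\<^esub> (\<sigma> x i \<odot>\<^bsub>estalk F i\<^esub> restr F x i (w x))"
        using E.smult_assoc1[OF _ _ r[OF x w], of "\<sigma> x i" a]
          E.smult_assoc1[OF _ _ r[OF x w], of a "\<sigma> x i"] by (simp add: mult.commute)
      ultimately show "t (a \<odot>\<^bsub>cochain0 G F\<^esub> w) i x = a \<odot>\<^bsub>estalk F i\<^esub> t w i x"
        using mem(2)[OF x w] by (simp add: t_def cochain0_def prod_vs_def)
    qed (use t w in \<open>auto intro!: E.smult_closed\<close>)
    also have "\<dots> = a \<odot>\<^bsub>estalk F i\<^esub> L w i"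
      unfolding L_def by (rule E.module.finsum_smult[symmetric, OF _ t[OF w]]) simp
    finally show "L (a \<odot>\<^bsub>cochain0 G F\<^esub> w) i = a \<odot>\<^bsub>estalk F i\<^esub> L w i" .
  qed
  show ?thesis
    by (rule linear_mapI[OF cochain_vectorspace])
      (auto simp: L cochain1_def prod_vs_def L_im L_add L_smult intro!: restrict_ext)
qed

lemma independent_sheaf_imp_surj:
  assumes "independent_sheaf G \<sigma> F"
  shows "coboundary G \<sigma> F ` carrier (cochain0 G F) = carrier (cochain1 G F)"
proof -
  interpret d: linear_map class_ring "cochain0 G F" "cochain1 G F" "coboundary G \<sigma> F"
    by (rule coboundary_linear)
  show ?thesis
    using quot_vs_trivialD[OF d.imT_is_subspace[unfolded d.im_def]] assms
    by (simp add: independent_sheaf_def cohomology1_def)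
qed

text \<open>Rank-nullity for the coboundary: its kernel is H^0, its image is all of C^1, and its
  source is the product of the vertex stalks.\<close>

lemma surj_imp_euler:
  assumes fin: "finite (gverts G)"
    and fd: "\<And>x. x \<in> gverts G \<Longrightarrow> vectorspace.fin_dim class_ring (vstalk F x)"
    and surj: "coboundary G \<sigma> F ` carrier (cochain0 G F) = carrier (cochain1 G F)"
  shows "rdim (cochain1 G F) + rdim (cohomology0 G \<sigma> F) = (\<Sum>x\<in>gverts G. rdim (vstalk F x))"
    and "vectorspace.fin_dim class_ring (cohomology0 G \<sigma> F)"
    and "real_vs (cohomology0 G \<sigma> F)"
proof -
  interpret d: linear_map class_ring "cochain0 G F" "cochain1 G F" "coboundary G \<sigma> F"
    by (rule coboundary_linear)
  have C0: "vectorspace.fin_dim class_ring (cochain0 G F)"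
    "rdim (cochain0 G F) = (\<Sum>x\<in>gverts G. rdim (vstalk F x))"
    using prod_vs_dim[OF fin, of "vstalk F"] fd F by (auto simp: cochain0_def sheaf_on_def)
  have H0: "cohomology0 G \<sigma> F = (cochain0 G F)\<lparr>carrier := d.kerT\<rparr>"
    by (simp add: cohomology0_def d.ker_def)
  show "rdim (cochain1 G F) + rdim (cohomology0 G \<sigma> F) = (\<Sum>x\<in>gverts G. rdim (vstalk F x))"
    using d.rank_nullity_surj[OF C0(1) surj] C0(2) by (simp add: H0)
  show "vectorspace.fin_dim class_ring (cohomology0 G \<sigma> F)"
    unfolding H0 by (rule vectorspace.subspace_dim_le[OF cochain_vectorspace(1) C0(1) d.kerT_is_subspace])
  show "real_vs (cohomology0 G \<sigma> F)"
    unfolding H0 by (rule vectorspace.subspace_is_vs[OF cochain_vectorspace(1) d.kerT_is_subspace])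
qed

text \<open>Every edge of \<open>G'\<close> has the same ends in both graphs, and these are vertices
  of \<open>G'\<close>; restricting a lift to \<open>G'\<close> therefore keeps its coboundary on
  those edges.\<close>

lemma coboundary_surj_subgraph:
  assumes surj: "coboundary G \<sigma> F ` carrier (cochain0 G F) = carrier (cochain1 G F)"
    and sub: "gverts G' \<subseteq> gverts G" "gedges G' \<subseteq> gedges G"
    and ends: "\<And>i. i \<in> gedges G' \<Longrightarrow> gends G' i = gends G i \<and> gends G i \<subseteq> gverts G'"
  shows "carrier (cochain1 G' F) \<subseteq> coboundary G' \<sigma> F ` carrier (cochain0 G' F)"
proof
  fix y assume y: "y \<in> carrier (cochain1 G' F)"
  \<comment> \<open>Extension of \<open>y\<close> by zero to the edges of \<open>G\<close> that are
    not in \<open>G'\<close>.\<close>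
  define z where "z = (\<lambda>i\<in>gedges G. if i \<in> gedges G' then y i else \<zero>\<^bsub>estalk F i\<^esub>)"
  have vs: "real_vs (estalk F i)" if "i \<in> gedges G" for i
    using F that by (simp add: sheaf_on_def)
  have zero: "\<zero>\<^bsub>estalk F i\<^esub> \<in> carrier (estalk F i)" if "i \<in> gedges G" for i
  proof -
    interpret vectorspace class_ring "estalk F i" by (rule vs[OF that])
    show ?thesis by (rule zero_closed)
  qed
  have "z \<in> carrier (cochain1 G F)"
    using y zero by (auto simp: z_def cochain1_def prod_vs_def)
  then obtain w where w: "w \<in> carrier (cochain0 G F)" "coboundary G \<sigma> F w = z"
    using surj by (metis imageE)
  \<comment> \<open>The claim is made for every \<open>i\<close>, since the two functions are
    compared by extensionality; off the edges of \<open>G'\<close> both are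
    \<open>undefined\<close>.\<close>
  have "coboundary G' \<sigma> F (restrict w (gverts G')) i = y i" for i
  proof (cases "i \<in> gedges G'")
    case True
    then have i: "i \<in> gedges G" using sub(2) by auto
    interpret E: vectorspace class_ring "estalk F i" by (rule vs[OF i])
    have "coboundary G' \<sigma> F (restrict w (gverts G')) i = coboundary G \<sigma> F w i"
      using True i ends[OF True] restr_closed[OF i _ w(1)]
      by (auto simp: coboundary_def intro!: E.finsum_cong' E.smult_closed)
    then show ?thesis using True i by (simp add: w(2) z_def)
  next
    case False
    then show ?thesis using y by (auto simp: coboundary_def cochain1_def prod_vs_def)
  qed
  moreover have "restrict w (gverts G') \<in> carrier (cochain0 G' F)"
    using w(1) sub(1) by (auto simp: cochain0_def prod_vs_def)
  ultimately show "y \<in> coboundary G' \<sigma> F ` carrier (cochain0 G' F)"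
    by (metis ext image_eqI)
qed

end

section \<open>Motion sheaves of a hypergraph and the dimensions of their cochains\<close>

locale hypergraph_motion =
  fixes V :: "'v set" and E :: "'v set set"
    and VV :: "'m rvs" and S :: "'v \<Rightarrow> 'm set"
    and \<sigma> :: "'v + 'v set \<Rightarrow> 'v \<times> 'v set \<Rightarrow> real"
  assumes hyp: "finite_hypergraph V E"
    and VV: "real_vs VV" and fd: "vectorspace.fin_dim class_ring VV"
    and S: "v \<in> V \<Longrightarrow> VectorSpace.subspace class_ring (S v) VV"
    and ori: "orientation (incidence_graph V E) \<sigma>"
begin

abbreviation "G \<equiv> incidence_graph V E"
text \<open>Built from \<open>VV\<close> and \<open>S\<close> alone, so the same sheaf serves every
  sub-hypergraph and only the incidence graph changes.\<close>

abbreviation "M \<equiv> motion_sheaf VV S"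
abbreviation "H0 \<equiv> cohomology0 G \<sigma> M"
abbreviation "mdim x \<equiv> rdim (vstalk M x)"

lemma finite_V: "finite V" and E_Pow: "E \<subseteq> Pow V"
  using hyp by (simp_all add: finite_hypergraph_def)

lemma finite_E: "finite E"
  using E_Pow finite_V by (auto intro: finite_subset)

lemma finite_hyperedge: "e \<in> E \<Longrightarrow> finite e"
  using E_Pow finite_V by (auto intro: finite_subset)

lemma finite_gverts: "finite (gverts G)"
  using finite_V finite_E by (simp add: incidence_graph_def)

lemma simple: "simple_graph G"
  by (rule incidence_graph_simple[OF hyp])

lemma sheaf: "sheaf_on G M"
  by (rule motion_sheaf_is_sheaf[OF hyp VV S])

lemma motion_space_subspace:
  assumes "x \<in> gverts G"
  shows "VectorSpace.subspace class_ring (motion_space VV S x) VV"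
proof (cases x)
  case (Inr e)
  then have "e \<subseteq> V" using assms hyp by (auto simp: incidence_graph_def finite_hypergraph_def)
  then show ?thesis using Inr S by (auto intro!: subspace_inter_space[OF VV])
qed (use assms S in \<open>auto simp: incidence_graph_def\<close>)

lemma vstalk_motion: "vstalk M x = quot_vs VV (motion_space VV S x)"
  by (simp add: motion_sheaf_def)

lemma stalk_fin_dim: "x \<in> gverts G \<Longrightarrow> vectorspace.fin_dim class_ring (vstalk M x)"
  unfolding vstalk_motion by (rule quot_vs_fin_dim[OF motion_space_subspace fd])

text \<open>The stalk on an incidence \<open>(v, e)\<close> equals the stalk at \<open>v\<close>, so
  grouping the incidences by hyperedge yields the double sum.\<close>

lemma rdim_cochain1: "rdim (cochain1 G M) = (\<Sum>e\<in>E. \<Sum>v\<in>e. mdim (Inl v))"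
proof -
  \<comment> \<open>Incidences are stored with the vertex first, whereas the dependent sum over
    hyperedges has the hyperedge first.\<close>
  let ?sw = "\<lambda>(e, v). (v, e)"
  have edges: "gedges G = ?sw ` (SIGMA e:E. e)" and sub: "\<And>v e. (v, e) \<in> gedges G \<Longrightarrow> v \<in> V"
    using hyp by (auto simp: incidence_graph_def finite_hypergraph_def)
  have fin: "finite (gedges G)"
    unfolding edges by (intro finite_imageI finite_SigmaI finite_E finite_hyperedge)
  have est: "estalk M (v, e) = vstalk M (Inl v)" for v e by (simp add: motion_sheaf_def)
  have "rdim (cochain1 G M) = (\<Sum>i\<in>gedges G. rdim (estalk M i))"
    unfolding cochain1_def
    using sub by (intro conjunct2[OF prod_vs_dim[OF fin]])
      (auto simp: motion_sheaf_def S intro!: quot_vs_vectorspace quot_vs_fin_dim fd)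
  also have "\<dots> = (\<Sum>(e, v)\<in>(SIGMA e:E. e). mdim (Inl v))"
    unfolding edges by (subst sum.reindex) (auto simp: inj_on_def est intro!: sum.cong)
  also have "\<dots> = (\<Sum>e\<in>E. \<Sum>v\<in>e. mdim (Inl v))"
    by (rule sum.Sigma[symmetric]) (auto intro: finite_E finite_hyperedge)
  finally show ?thesis .
qed

lemma sum_gverts: "(\<Sum>x\<in>gverts G. mdim x) = (\<Sum>v\<in>V. mdim (Inl v)) + (\<Sum>e\<in>E. mdim (Inr e))"
proof -
  have "(\<Sum>x\<in>gverts G. mdim x) = sum mdim (Inl ` V) + sum mdim (Inr ` E)"
    using hyp finite_E
    by (auto simp: incidence_graph_def finite_hypergraph_def intro!: sum.union_disjoint)
  then show ?thesis by (simp add: sum.reindex)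
qed

section \<open>The diagonal map into H^0 and the dimension count\<close>

definition diag :: "'m \<Rightarrow> 'v + 'v set \<Rightarrow> 'm set" where
  "diag W = (\<lambda>x\<in>gverts G. motion_space VV S x +>\<^bsub>VV\<^esub> W)"

text \<open>At an incidence \<open>(v, e)\<close> both ends contribute the class of \<open>W\<close>
  modulo \<open>S v\<close>, with opposite signs, and so cancel.\<close>

lemma diag_H0:
  assumes W: "W \<in> carrier VV"
  shows "diag W \<in> carrier H0"
proof -
  have "finsum (estalk M i) (\<lambda>x. \<sigma> x i \<odot>\<^bsub>estalk M i\<^esub> restr M x i (diag W x)) (gends G i) =
      \<zero>\<^bsub>estalk M i\<^esub>" if i: "i \<in> gedges G" for i
  proof -
    obtain v e where ve: "i = (v, e)" "v \<in> V" "e \<in> E" "v \<in> e"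
      using i by (auto simp: incidence_graph_def)
    have vx: "Inl v \<in> gverts G" "Inr e \<in> gverts G" using ve by (auto simp: incidence_graph_def)
    define Q where "Q = quot_vs VV (S v)"
    interpret Q: vectorspace class_ring Q
      unfolding Q_def by (rule quot_vs_vectorspace[OF S[OF ve(2)]])
    define q where "q = S v +>\<^bsub>VV\<^esub> W"
    have q: "q \<in> carrier Q" using W by (simp add: q_def Q_def carrier_quot_vs)
    have est: "estalk M i = Q" by (simp add: motion_sheaf_def ve Q_def)
    have sub: "inter_space VV S e \<subseteq> S v" using ve by (auto simp: inter_space_def)
    have rl: "restr M (Inl v) i (diag W (Inl v)) = q"
      using vx by (simp add: motion_sheaf_def ve diag_def q_def)
    \<comment> \<open>As \<open>v\<close> belongs to \<open>e\<close>, the space of \<open>e\<close>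
      lies in \<open>S v\<close>, and reduction sends the coset of \<open>W\<close> to the coset of
      \<open>W\<close>.\<close>
    have rr: "restr M (Inr e) i (diag W (Inr e)) = q"
      using vx coset_reduce[OF motion_space_subspace[OF vx(2)] motion_space_subspace[OF vx(1)] _ W] sub
      by (simp add: motion_sheaf_def ve diag_def q_def)
    have ends: "gends G i = {Inl v, Inr e}" by (simp add: incidence_graph_def ve)
    \<comment> \<open>The ends lie in different summands of the sum type and are thus distinct, as
      the sign rule of an orientation requires.\<close>
    have sg: "\<sigma> (Inr e) i = - \<sigma> (Inl v) i"
      using ori i ends unfolding orientation_def by (metis insertCI sum.distinct(2))
    have "finsum Q (\<lambda>x. \<sigma> x i \<odot>\<^bsub>Q\<^esub> restr M x i (diag W x)) {Inl v, Inr e} =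
        \<sigma> (Inl v) i \<odot>\<^bsub>Q\<^esub> q \<oplus>\<^bsub>Q\<^esub> \<sigma> (Inr e) i \<odot>\<^bsub>Q\<^esub> q"
      using q by (subst Q.finsum_insert) (auto simp: rl rr Q.smult_closed)
    also have "\<dots> = (\<sigma> (Inl v) i + \<sigma> (Inr e) i) \<odot>\<^bsub>Q\<^esub> q"
      using Q.smult_l_distr[OF _ _ q, of "\<sigma> (Inl v) i" "\<sigma> (Inr e) i"] by simp
    also have "\<dots> = \<zero>\<^bsub>Q\<^esub>" using Q.lmult_0[OF q] by (simp add: sg)
    finally show ?thesis by (simp add: est ends)
  qed
  then show ?thesis
    using W by (auto simp: cohomology0_def coboundary_def cochain0_def cochain1_def prod_vs_def
        diag_def vstalk_motion carrier_quot_vs intro!: restrict_ext)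
qed

lemma diag_linear:
  assumes "real_vs H0"
  shows "linear_map class_ring VV H0 diag"
proof (rule linear_mapI[OF VV assms diag_H0])
  note lin = coset_linear[OF motion_space_subspace]
  fix u v assume "u \<in> carrier VV" "v \<in> carrier VV"
  then show "diag (u \<oplus>\<^bsub>VV\<^esub> v) = diag u \<oplus>\<^bsub>H0\<^esub> diag v"
    using LinearCombinations.module_hom_add[OF mod_hom.f_hom[OF linear_map.axioms(3)[OF lin]]]
    by (auto simp: cohomology0_def cochain0_def prod_vs_def diag_def vstalk_motion intro!: restrict_ext)
next
  note lin = coset_linear[OF motion_space_subspace]
  fix a :: real and v assume "a \<in> carrier class_ring" "v \<in> carrier VV"
  then show "diag (a \<odot>\<^bsub>VV\<^esub> v) = a \<odot>\<^bsub>H0\<^esub> diag v"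
    using LinearCombinations.module_hom_smult[OF mod_hom.f_hom[OF linear_map.axioms(3)[OF lin]]]
    by (auto simp: cohomology0_def cochain0_def prod_vs_def diag_def vstalk_motion intro!: restrict_ext)
qed

text \<open>If the diagonal image of \<open>W\<close> vanishes, its coordinate at each vertex
  \<open>v\<close> puts \<open>W\<close> into \<open>S v\<close>, hence into the trivial
  intersection.\<close>

lemma diag_inj:
  assumes H: "real_vs H0" and S0: "inter_space VV S V = {\<zero>\<^bsub>VV\<^esub>}"
  shows "inj_on diag (carrier VV)"
proof -
  interpret d: linear_map class_ring VV H0 diag by (rule diag_linear[OF H])
  have "W = \<zero>\<^bsub>VV\<^esub>" if W: "W \<in> carrier VV" "diag W = \<zero>\<^bsub>H0\<^esub>" for W
  proof -
    have "W \<in> S v" if v: "v \<in> V" for v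
    proof -
      have x: "Inl v \<in> gverts G" using v by (simp add: incidence_graph_def)
      interpret abelian_subgroup "S v" VV by (rule subspace_abelian_subgroup[OF S[OF v]])
      have "S v +>\<^bsub>VV\<^esub> W = S v"
        using fun_cong[OF W(2), of "Inl v"] x
        by (simp add: cohomology0_def cochain0_def prod_vs_def diag_def vstalk_motion quot_vs_def)
      then show ?thesis using a_rcos_self[OF W(1)] by simp
    qed
    then have "W \<in> inter_space VV S V" using W(1) by (simp add: inter_space_def)
    then show ?thesis by (simp add: S0)
  qed
  then have "carrier (VV\<lparr>carrier := d.kerT\<rparr>) = {\<zero>\<^bsub>VV\<^esub>}" by (auto simp: d.ker_def)
  then show ?thesis by (rule d.Ke0_imp_inj)
qed

text \<open>The first claim is the Euler identity rearranged over the integers. The other two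
  compare \<open>VV\<close> with H^0 through \<open>diag\<close>, which is injective, and also onto
  under rigidity.\<close>

lemma independence_count:
  assumes surj: "coboundary G \<sigma> M ` carrier (cochain0 G M) = carrier (cochain1 G M)"
    and S0: "inter_space VV S V = {\<zero>\<^bsub>VV\<^esub>}"
  shows "(\<Sum>e\<in>E. (\<Sum>v\<in>e. int (mdim (Inl v))) - int (mdim (Inr e)))
      = (\<Sum>v\<in>V. int (mdim (Inl v))) - int (rdim H0)"
    and "rdim VV \<le> rdim H0"
    and "motion_rigid V E \<sigma> VV S \<Longrightarrow> rdim VV = rdim H0"
proof -
  have euler: "rdim (cochain1 G M) + rdim H0 = (\<Sum>x\<in>gverts G. mdim x)"
    "vectorspace.fin_dim class_ring H0" "real_vs H0"
    by (rule surj_imp_euler[OF simple sheaf finite_gverts _ surj], erule stalk_fin_dim)+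
  interpret d: linear_map class_ring VV H0 diag by (rule diag_linear[OF euler(3)])
  have "int (\<Sum>e\<in>E. \<Sum>v\<in>e. mdim (Inl v)) + int (rdim H0)
      = int (\<Sum>v\<in>V. mdim (Inl v)) + int (\<Sum>e\<in>E. mdim (Inr e))"
    using euler(1) by (simp only: rdim_cochain1 sum_gverts flip: of_nat_add)
  then show "(\<Sum>e\<in>E. (\<Sum>v\<in>e. int (mdim (Inl v))) - int (mdim (Inr e)))
      = (\<Sum>v\<in>V. int (mdim (Inl v))) - int (rdim H0)"
    by (simp add: sum_subtractf)
  note inj = diag_inj[OF euler(3) S0]
  show "rdim VV \<le> rdim H0" by (rule d.inj_dim_le[OF fd euler(2) inj])
  assume "motion_rigid V E \<sigma> VV S"
  \<comment> \<open>The families that rigidity allows in H^0 are exactly the values of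
    \<open>diag\<close>.\<close>
  then have "diag ` carrier VV = carrier H0"
    using diag_H0 by (auto simp: motion_rigid_def diag_def[abs_def])
  then show "rdim VV = rdim H0" by (rule d.dim_eq[OF fd inj])
qed

section \<open>Passage to sub-hypergraphs and the two counts\<close>

lemma sub_hypergraph_motion:
  assumes "sub_hypergraph V' E' V E"
  shows "hypergraph_motion V' E' VV S \<sigma>"
proof (rule hypergraph_motion.intro)
  have sub: "V' \<subseteq> V" "E' \<subseteq> E" "\<And>e. e \<in> E' \<Longrightarrow> e \<subseteq> V'"
    using assms by (auto simp: sub_hypergraph_def)
  \<comment> \<open>Containment of each hyperedge in \<open>V'\<close> ensures that its incidences
    all survive, so the inner sums still run over the whole hyperedge.\<close>
  show "finite_hypergraph V' E'"
    using hyp sub finite_subset by (auto simp: finite_hypergraph_def)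
  \<comment> \<open>The incidences of the sub-hypergraph are incidences of the whole with the same
    ends, so the same signs work.\<close>
  show "orientation (incidence_graph V' E') \<sigma>"
    using ori sub(1,2) unfolding orientation_def incidence_graph_def by fastforce
  show "VectorSpace.subspace class_ring (S v) VV" if "v \<in> V'" for v
    using S sub(1) that by blast
qed (rule VV fd)+

text \<open>Lifts come from the larger graph by restriction; the other inclusion only says that the
  coboundary of the sub-hypergraph maps into its own C^1.\<close>

lemma sub_hypergraph_surj:
  assumes "motion_independent V E \<sigma> VV S" and sub: "sub_hypergraph V' E' V E"
  shows "coboundary (incidence_graph V' E') \<sigma> M ` carrier (cochain0 (incidence_graph V' E') M) =
    carrier (cochain1 (incidence_graph V' E') M)"
proof (intro equalityI)
  interpret sub: hypergraph_motion V' E' VV S \<sigma> by (rule sub_hypergraph_motion[OF sub])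
  interpret d: linear_map class_ring "cochain0 sub.G M" "cochain1 sub.G M" "coboundary sub.G \<sigma> M"
    by (rule coboundary_linear[OF sub.simple sub.sheaf])
  show "coboundary sub.G \<sigma> M ` carrier (cochain0 sub.G M) \<subseteq> carrier (cochain1 sub.G M)"
    by auto
  have surj: "coboundary G \<sigma> M ` carrier (cochain0 G M) = carrier (cochain1 G M)"
    using assms(1) unfolding motion_independent_def
    by (rule independent_sheaf_imp_surj[OF simple sheaf])
  show "carrier (cochain1 sub.G M) \<subseteq> coboundary sub.G \<sigma> M ` carrier (cochain0 sub.G M)"
    using sub by (intro coboundary_surj_subgraph[OF simple sheaf surj])
      (auto simp: incidence_graph_def sub_hypergraph_def)
qed

end

theorem mainTheorem8:
  fixes V :: "'v set" and E :: "'v set set"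
    and VV :: "'m rvs" and S :: "'v \<Rightarrow> 'm set"
    and \<sigma> :: "'v + 'v set \<Rightarrow> 'v \<times> 'v set \<Rightarrow> real"
  assumes "finite_hypergraph V E"
    and "real_vs VV" and "vectorspace.fin_dim class_ring VV"
    and "\<And>v. v \<in> V \<Longrightarrow> VectorSpace.subspace class_ring (S v) VV"
    and "inter_space VV S V = {\<zero>\<^bsub>VV\<^esub>}"
    and "orientation (incidence_graph V E) \<sigma>"
  shows
    "(motion_independent V E \<sigma> VV S \<longrightarrow>
       (\<forall>V' E'. sub_hypergraph V' E' V E \<and> inter_space VV S V' = {\<zero>\<^bsub>VV\<^esub>} \<longrightarrow>
          (\<Sum>e\<in>E'. (\<Sum>v\<in>e. int (rdim (vstalk (motion_sheaf VV S) (Inl v))))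
                  - int (rdim (vstalk (motion_sheaf VV S) (Inr e))))
          \<le> (\<Sum>v\<in>V'. int (rdim (vstalk (motion_sheaf VV S) (Inl v)))) - int (rdim VV))) \<and>
     (motion_minimally_rigid V E \<sigma> VV S \<longrightarrow>
        (\<Sum>e\<in>E. (\<Sum>v\<in>e. int (rdim (vstalk (motion_sheaf VV S) (Inl v))))
               - int (rdim (vstalk (motion_sheaf VV S) (Inr e))))
        = (\<Sum>v\<in>V. int (rdim (vstalk (motion_sheaf VV S) (Inl v)))) - int (rdim VV))"
proof (intro conjI impI allI)
  interpret hypergraph_motion V E VV S \<sigma> using assms by (intro hypergraph_motion.intro)
  {
    fix V' E'
    assume ind: "motion_independent V E \<sigma> VV S"
      and "sub_hypergraph V' E' V E \<and> inter_space VV S V' = {\<zero>\<^bsub>VV\<^esub>}"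
    then have sub: "sub_hypergraph V' E' V E" and S0: "inter_space VV S V' = {\<zero>\<^bsub>VV\<^esub>}" by auto
    interpret sub: hypergraph_motion V' E' VV S \<sigma> by (rule sub_hypergraph_motion[OF sub])
    show "(\<Sum>e\<in>E'. (\<Sum>v\<in>e. int (mdim (Inl v))) - int (mdim (Inr e)))
        \<le> (\<Sum>v\<in>V'. int (mdim (Inl v))) - int (rdim VV)"
      using sub.independence_count(1,2)[OF sub_hypergraph_surj[OF ind sub] S0] by simp
  }
  assume "motion_minimally_rigid V E \<sigma> VV S"
  then have ind: "motion_independent V E \<sigma> VV S" and rigid: "motion_rigid V E \<sigma> VV S"
    by (auto simp: motion_minimally_rigid_def)
  \<comment> \<open>Taking the whole as a sub-hypergraph of itself gives surjectivity on the full
    incidence graph; rigidity then replaces the dimension of H^0 by that of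
    \<open>VV\<close>.\<close>
  have "sub_hypergraph V E V E"
    using assms(1) by (auto simp: sub_hypergraph_def finite_hypergraph_def)
  note count = independence_count[OF sub_hypergraph_surj[OF ind this] assms(5)]
  show "(\<Sum>e\<in>E. (\<Sum>v\<in>e. int (mdim (Inl v))) - int (mdim (Inr e)))
      = (\<Sum>v\<in>V. int (mdim (Inl v))) - int (rdim VV)"
    using count(1) count(3)[OF rigid] by simp
qed

end
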